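(* Let $K$ be a field, let $P_n=\{p_1,\dots,p_n\}$ and $P'_n=\{p'_1,\dots,p'_n\}$ be two isomorphic finite posets with $n$ elements, and let $G=G(P_n)$ and $G'=G(P'_n)$. Then the cover ideals $I_G$ and $I_{G'}$ are isomorphic as graded $K$-vector spaces and, consequently, the Hilbert functions and the Hilbert series of $A(G)$ and $A(G')$ coincide.
   Context: For a poset $P_n=\{p_1,\dots,p_n\}$, $G(P_n)$ is the bipartite graph on $V_n=\{x_1,\dots,x_n\}\cup\{y_1,\dots,y_n\}$ whose edges are all $\{x_i,y_j\}$ with $p_i\le p_j$. A poset isomorphism is a bijection $f$ with $p\le q$ if and only if $f(p)\le f(q)$. Let $S=K[x_1,\dots,x_n,y_1,\dots,y_n]$. A $k$-vertex cover of $G$ ($k\in\mathbb N$, $0\in\mathbb N$) is a vector $c\in\mathbb N^{2n}$, indexed by the vertices, with $c(v)+c(w)\ge k$ for every edge $\{v,w\}$. The cover ideal $I_G\subset S$ is the ideal generated by all monomials $x_1^{c_1}\cdots x_n^{c_n}y_1^{c_{n+1}}\cdots y_n^{c_{2n}}$ with $c$ a $1$-vertex cover; it is graded by the usual degree. The vertex cover algebra $A(G)$ is the subalgebra of $S[t]$ generated over $K$ by all monomials $x_1^{c_1}\cdots x_n^{c_n}y_1^{c_{n+1}}\cdots y_n^{c_{2n}}t^k$ with $c$ a $k$-vertex cover, $k\in\mathbb N$. It is known that $A(G)=\bigoplus_{k\ge0}I_G^kt^k$, that $I_G$ is minimally generated by the monomials $m_C=\prod_{v\in C}v$, $C$ a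 minimal vertex cover of $G$, and that each such $C$ has exactly $n$ elements. $A(G)$ is a standard graded $K$-algebra by giving degree $1$ to each $x_i$, each $y_j$ and each $m_Ct$. *)

theory Defs
  imports
    "HOL-Library.Poly_Mapping"
    "HOL-Computational_Algebra.Polynomial"
    "HOL-Computational_Algebra.Formal_Power_Series"
begin

section \<open>Posets and their bipartite graphs\<close>

definition poset_iso :: "'a set \<Rightarrow> 'a rel \<Rightarrow> 'b set \<Rightarrow> 'b rel \<Rightarrow> ('a \<Rightarrow> 'b) \<Rightarrow> bool" where
  "poset_iso P r P' r' f \<longleftrightarrow>
     bij_betw f P P' \<and> (\<forall>a\<in>P. \<forall>b\<in>P. (a, b) \<in> r \<longleftrightarrow> (f a, f b) \<in> r')"

text \<open>A graph is a pair of a vertex set and a set of edges, each edge being a set of two vertices.\<close>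

type_synonym 'v graph = "'v set \<times> 'v set set"

abbreviation vertices :: "'v graph \<Rightarrow> 'v set" where "vertices G \<equiv> fst G"
abbreviation edges :: "'v graph \<Rightarrow> 'v set set" where "edges G \<equiv> snd G"

datatype vertex = X nat | Y nat

definition poset_graph :: "nat \<Rightarrow> (nat \<Rightarrow> 'a) \<Rightarrow> 'a rel \<Rightarrow> vertex graph" where
  "poset_graph n p r =
     (X ` {1..n} \<union> Y ` {1..n},
      {{X i, Y j} | i j. i \<in> {1..n} \<and> j \<in> {1..n} \<and> (p i, p j) \<in> r})"

section \<open>Vertex covers\<close>

text \<open>A vector indexed by the vertices is a finitely supported function whose support lies in the
  vertex set, so that it is at the same time the exponent vector of a monomial.\<close>

definition k_vertex_cover :: "'v graph \<Rightarrow> nat \<Rightarrow> ('v \<Rightarrow>\<^sub>0 nat) \<Rightarrow> bool" where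
  "k_vertex_cover G k c \<longleftrightarrow> Poly_Mapping.keys c \<subseteq> vertices G \<and>
     (\<forall>v w. {v, w} \<in> edges G \<longrightarrow> Poly_Mapping.lookup c v + Poly_Mapping.lookup c w \<ge> k)"

definition vertex_cover :: "'v graph \<Rightarrow> 'v set \<Rightarrow> bool" where
  "vertex_cover G C \<longleftrightarrow> C \<subseteq> vertices G \<and> (\<forall>e\<in>edges G. e \<inter> C \<noteq> {})"

definition minimal_vertex_cover :: "'v graph \<Rightarrow> 'v set \<Rightarrow> bool" where
  "minimal_vertex_cover G C \<longleftrightarrow> vertex_cover G C \<and> (\<forall>D. D \<subset> C \<longrightarrow> \<not> vertex_cover G D)"

section \<open>The polynomial ring and the cover ideal\<close>

text \<open>Polynomials are finitely supported functions from exponent vectors to coefficients; the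
  product on \<open>\<Rightarrow>\<^sub>0\<close> is convolution.\<close>

type_synonym ('v, 'k) mpoly = "('v \<Rightarrow>\<^sub>0 nat) \<Rightarrow>\<^sub>0 'k"

definition mmonom :: "('v \<Rightarrow>\<^sub>0 nat) \<Rightarrow> ('v, 'k::field) mpoly" where
  "mmonom c = Poly_Mapping.single c 1"

definition mconst :: "'k::field \<Rightarrow> ('v, 'k) mpoly" where
  "mconst a = Poly_Mapping.single 0 a"

definition var :: "'v \<Rightarrow> ('v, 'k::field) mpoly" where
  "var v = mmonom (Poly_Mapping.single v 1)"

text \<open>The polynomial ring \<open>K[v | v \<in> V]\<close>.\<close>

definition poly_ring :: "'v set \<Rightarrow> ('v, 'k::field) mpoly set" where
  "poly_ring V = {q. \<forall>c\<in>Poly_Mapping.keys q. Poly_Mapping.keys c \<subseteq> V}"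

definition homogeneous_part :: "nat \<Rightarrow> ('v, 'k::field) mpoly set" where
  "homogeneous_part d = {q. \<forall>c\<in>Poly_Mapping.keys q. (\<Sum>v\<in>Poly_Mapping.keys c. Poly_Mapping.lookup c v) = d}"

definition is_ideal :: "('v, 'k::field) mpoly set \<Rightarrow> ('v, 'k) mpoly set \<Rightarrow> bool" where
  "is_ideal S I \<longleftrightarrow> I \<subseteq> S \<and> 0 \<in> I \<and> (\<forall>a\<in>I. \<forall>b\<in>I. a + b \<in> I) \<and> (\<forall>s\<in>S. \<forall>a\<in>I. s * a \<in> I)"

definition cover_ideal :: "'v graph \<Rightarrow> ('v, 'k::field) mpoly set" where
  "cover_ideal G = is_ideal (poly_ring (vertices G)) hull {mmonom c | c. k_vertex_cover G 1 c}"

text \<open>Isomorphism of graded \<open>K\<close>-vector spaces, for graded subspaces of polynomial rings graded by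
  total degree.  Only the values of \<open>\<phi>\<close> on \<open>U\<close> matter.\<close>

definition graded_vs_isomorphic :: "('v, 'k::field) mpoly set \<Rightarrow> ('w, 'k) mpoly set \<Rightarrow> bool" where
  "graded_vs_isomorphic U W \<longleftrightarrow> (\<exists>\<phi>.
     (\<forall>a\<in>U. \<forall>b\<in>U. \<phi> (a + b) = \<phi> a + \<phi> b) \<and>
     (\<forall>s. \<forall>a\<in>U. \<phi> (mconst s * a) = mconst s * \<phi> a) \<and>
     bij_betw \<phi> U W \<and>
     (\<forall>d. \<phi> ` (U \<inter> homogeneous_part d) = W \<inter> homogeneous_part d))"

section \<open>The vertex cover algebra\<close>

text \<open>Elements of \<open>S[t]\<close> are univariate polynomials over the polynomial ring; \<open>monom u k\<close> is
  \<open>u t\<^sup>k\<close>.\<close>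

definition kscale :: "'k::field \<Rightarrow> ('v, 'k) mpoly poly \<Rightarrow> ('v, 'k) mpoly poly" where
  "kscale a q = smult (mconst a) q"

lemma vector_space_kscale: "vector_space (kscale :: 'k::field \<Rightarrow> ('v, 'k) mpoly poly \<Rightarrow> _)"
  by unfold_locales
    (simp_all add: kscale_def mconst_def smult_add_right smult_add_left single_add mult_single)

definition is_subalgebra :: "('v, 'k::field) mpoly poly set \<Rightarrow> bool" where
  "is_subalgebra A \<longleftrightarrow> (\<forall>a. kscale a 1 \<in> A) \<and> (\<forall>f\<in>A. \<forall>g\<in>A. f + g \<in> A \<and> f * g \<in> A)"

definition vertex_cover_algebra :: "'v graph \<Rightarrow> ('v, 'k::field) mpoly poly set" where
  "vertex_cover_algebra G = is_subalgebra hull {monom (mmonom c) k | c k. k_vertex_cover G k c}"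

text \<open>The elements which are given degree 1 in the standard grading of the vertex cover algebra.\<close>

definition degree_one_generators :: "'v graph \<Rightarrow> ('v, 'k::field) mpoly poly set" where
  "degree_one_generators G =
     {monom (var v) 0 | v. v \<in> vertices G} \<union>
     {monom (\<Prod>v\<in>C. var v) 1 | C. minimal_vertex_cover G C}"

text \<open>For an algebra \<open>A\<close> that is standard graded by giving degree 1 to the elements of \<open>D\<close>, the
  component of degree \<open>d\<close> is spanned by the products of \<open>d\<close> elements of \<open>D\<close>.\<close>

definition standard_component ::
  "('v, 'k::field) mpoly poly set \<Rightarrow> ('v, 'k) mpoly poly set \<Rightarrow> nat \<Rightarrow> ('v, 'k) mpoly poly set" where
  "standard_component A D d =
     A \<inter> module.span kscale {prod_list fs | fs. set fs \<subseteq> D \<and> length fs = d}"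

definition hilbert_function ::
  "('v, 'k::field) mpoly poly set \<Rightarrow> ('v, 'k) mpoly poly set \<Rightarrow> nat \<Rightarrow> nat" where
  "hilbert_function A D d = vector_space.dim kscale (standard_component A D d)"

definition hilbert_series ::
  "('v, 'k::field) mpoly poly set \<Rightarrow> ('v, 'k) mpoly poly set \<Rightarrow> int fps" where
  "hilbert_series A D = Abs_fps (\<lambda>d. int (hilbert_function A D d))"

end

(* An isomorphism of posets permutes the indices 1..n and hence the vertices, carrying one graph onto
   the other.  The permutation of the variables it induces extends to degree-preserving ring
   automorphisms of S and S[t] over K, which carry cover ideal to cover ideal and vertex cover algebra
   to vertex cover algebra, together with the degree-one generators. *)
theory Submission
  imports Defs
begin

section \<open>Hulls under bijections and dimensions under injective linear maps\<close>

text \<open>Taking images under \<open>F\<close> matches the \<open>S\<close>-sets containing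
  \<open>A\<close> with the \<open>S'\<close>-sets containing the image of \<open>A\<close>, and
  images under a bijection commute with intersections. This transports ideals and subalgebras given
  by generators.\<close>

lemma hull_image_bij:
  assumes "bij F" and "\<And>t. S' (F ` t) \<longleftrightarrow> S t"
  shows "F ` (S hull A) = S' hull (F ` A)"
proof
  have "F ` (S hull A) \<subseteq> t" if "S' t" "F ` A \<subseteq> t" for t
  proof -
    have t: "F ` (F -` t) = t"
      using assms(1) by (simp add: bij_is_surj surj_image_vimage_eq)
    with that(1) assms(2) have "S (F -` t)"
      by metis
    moreover have "A \<subseteq> F -` t"
      using that(2) by blast
    ultimately have "S hull A \<subseteq> F -` t"
      by (rule hull_minimal[rotated])
    then show ?thesis
      by blast
  qed
  then show "F ` (S hull A) \<subseteq> S' hull (F ` A)"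
    unfolding hull_def[of S'] by blast
next
  have "x \<in> F ` (S hull A)" if x: "x \<in> S' hull (F ` A)" for x
  proof -
    obtain y where y: "x = F y"
      using assms(1) by (meson bij_pointE)
    have "y \<in> t" if "S t" "A \<subseteq> t" for t
    proof -
      have "S' hull (F ` A) \<subseteq> F ` t"
        using that assms(2) by (intro hull_minimal) auto
      with x y show ?thesis
        using assms(1) by (auto dest: bij_is_inj injD)
    qed
    then show ?thesis
      unfolding hull_def y by blast
  qed
  then show "S' hull (F ` A) \<subseteq> F ` (S hull A)"
    by blast
qed

text \<open>A basis of \<open>V\<close> maps injectively to a basis of the image. An infinite basis
  has \<open>card\<close> 0, as does its image, so infinite dimension is covered too.\<close>

lemma dim_image_inj:
  assumes "Vector_Spaces.linear s1 s2 f" and "inj f"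
  shows "vector_space.dim s2 (f ` V) = vector_space.dim s1 V"
proof -
  interpret f: Vector_Spaces.linear s1 s2 f by fact
  obtain B where B: "B \<subseteq> V" "f.vs1.independent B" "V \<subseteq> f.vs1.span B" "card B = f.vs1.dim V"
    by (rule f.vs1.basis_exists)
  have "f.vs2.independent (f ` B)"
    using B(2) assms(2) by (rule f.independent_inj_image)
  moreover have "f ` V \<subseteq> f.vs2.span (f ` B)"
    using B(3) by (auto simp: f.span_image)
  moreover have "card (f ` B) = f.vs1.dim V"
    using assms(2) B(4) by (metis card_image inj_on_subset subset_UNIV)
  ultimately show ?thesis
    using B(1) by (intro f.vs2.dim_unique[of "f ` B"]) auto
qed

section \<open>Relabelling the variables\<close>

text \<open>\<open>map_key\<close> pulls back along its argument, so the inverse is taken in order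
  to move the exponent of \<open>v\<close> to \<open>\<pi> v\<close>. The definition is meant for
  bijective \<open>\<pi>\<close>.\<close>

definition rename_mon :: "('v \<Rightarrow> 'w) \<Rightarrow> ('v \<Rightarrow>\<^sub>0 nat) \<Rightarrow> ('w \<Rightarrow>\<^sub>0 nat)" where
  "rename_mon \<pi> = Poly_Mapping.map_key (inv \<pi>)"

definition rename_poly :: "('v \<Rightarrow> 'w) \<Rightarrow> ('v, 'k::field) mpoly \<Rightarrow> ('w, 'k) mpoly" where
  "rename_poly \<pi> = Poly_Mapping.map_key (inv (rename_mon \<pi>))"

definition rename_tpoly :: "('v \<Rightarrow> 'w) \<Rightarrow> ('v, 'k::field) mpoly poly \<Rightarrow> ('w, 'k) mpoly poly" where
  "rename_tpoly \<pi> = map_poly (rename_poly \<pi>)"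

definition relabel_graph :: "('v \<Rightarrow> 'w) \<Rightarrow> 'v graph \<Rightarrow> 'w graph" where
  "relabel_graph \<pi> G = (\<pi> ` vertices G, (`) \<pi> ` edges G)"

text \<open>Stated for an arbitrary bijection of keys because it serves at two levels: for
  \<open>\<pi>\<close> on exponent vectors and for \<open>rename_mon \<pi>\<close> on
  polynomials.\<close>

lemma map_key_inv:
  fixes f :: "'a \<Rightarrow> 'b"
  assumes "bij f"
  shows "bij (Poly_Mapping.map_key (inv f) :: ('a \<Rightarrow>\<^sub>0 'c::zero) \<Rightarrow> _)"
    and "Poly_Mapping.lookup (Poly_Mapping.map_key (inv f) p) (f x) = Poly_Mapping.lookup p x"
    and "Poly_Mapping.keys (Poly_Mapping.map_key (inv f) p) = f ` Poly_Mapping.keys p"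
    and "Poly_Mapping.map_key (inv f) (Poly_Mapping.single x c) = Poly_Mapping.single (f x) c"
proof -
  have inj: "inj (inv f)" "inj f"
    using assms by (simp_all add: bij_is_surj surj_imp_inj_inv bij_is_inj)
  have "Poly_Mapping.map_key f (Poly_Mapping.map_key (inv f) q) = q" for q :: "'a \<Rightarrow>\<^sub>0 'c"
    using inj by (simp add: map_key_compose map_key_id[unfolded id_def[symmetric]])
  moreover have "inv f \<circ> f = id" "f \<circ> inv f = id"
    using assms by (simp_all add: bij_is_inj bij_is_surj surj_iff[symmetric])
  then have "Poly_Mapping.map_key (inv f) (Poly_Mapping.map_key f q) = q" for q :: "'b \<Rightarrow>\<^sub>0 'c"
    using inj by (simp add: map_key_compose map_key_id[unfolded id_def[symmetric]])
  ultimately show "bij (Poly_Mapping.map_key (inv f) :: ('a \<Rightarrow>\<^sub>0 'c) \<Rightarrow> _)"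
    by (intro o_bij[of "Poly_Mapping.map_key f"]) auto
  show "Poly_Mapping.lookup (Poly_Mapping.map_key (inv f) p) (f x) = Poly_Mapping.lookup p x"
    using inj by (simp add: map_key.rep_eq)
  show "Poly_Mapping.keys (Poly_Mapping.map_key (inv f) p) = f ` Poly_Mapping.keys p"
    using inj assms by (simp add: keys_map_key bij_vimage_eq_inv_image bij_imp_bij_inv inv_inv_eq)
  show "Poly_Mapping.map_key (inv f) (Poly_Mapping.single x c) = Poly_Mapping.single (f x) c"
    using map_key_single[OF inj(1), of "f x" c] inj(2) by simp
qed

context
  fixes \<pi> :: "'v \<Rightarrow> 'w"
  assumes bij: "bij \<pi>"
begin

lemma inj_pi: "inj \<pi>"
  using bij by (rule bij_is_inj)

lemma
  shows bij_rename_mon: "bij (rename_mon \<pi>)"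
    and lookup_rename_mon:
      "Poly_Mapping.lookup (rename_mon \<pi> c) (\<pi> v) = Poly_Mapping.lookup c v"
    and keys_rename_mon: "Poly_Mapping.keys (rename_mon \<pi> c) = \<pi> ` Poly_Mapping.keys c"
    and rename_mon_single:
      "rename_mon \<pi> (Poly_Mapping.single v k) = Poly_Mapping.single (\<pi> v) k"
  unfolding rename_mon_def by (rule map_key_inv[OF bij])+

lemma rename_mon_0: "rename_mon \<pi> 0 = 0"
  and rename_mon_add: "rename_mon \<pi> (c + d) = rename_mon \<pi> c + rename_mon \<pi> d"
  using bij by (simp_all add: rename_mon_def map_key_plus bij_is_surj surj_imp_inj_inv)

section \<open>Renaming as an isomorphism of polynomial rings\<close>

lemma
  fixes q :: "('v, 'k::field) mpoly"
  shows bij_rename_poly: "bij (rename_poly \<pi> :: ('v, 'k) mpoly \<Rightarrow> _)"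
    and keys_rename_poly:
      "Poly_Mapping.keys (rename_poly \<pi> q) = rename_mon \<pi> ` Poly_Mapping.keys q"
    and rename_poly_single:
      "rename_poly \<pi> (Poly_Mapping.single c a) = Poly_Mapping.single (rename_mon \<pi> c) (a::'k)"
  unfolding rename_poly_def by (rule map_key_inv[OF bij_rename_mon])+

lemma rename_poly_0: "rename_poly \<pi> 0 = 0"
  and rename_poly_add: "rename_poly \<pi> (q + q') = rename_poly \<pi> q + rename_poly \<pi> q'"
  using bij_rename_mon
  by (simp_all add: rename_poly_def map_key_plus bij_is_surj surj_imp_inj_inv)

text \<open>Both sides are additive in each factor, so the claim reduces to products of two terms,
  where it is the additivity of \<open>rename_mon \<pi>\<close>.\<close>

lemma rename_poly_mult: "rename_poly \<pi> (q * q') = rename_poly \<pi> q * rename_poly \<pi> q'"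
proof -
  \<comment> \<open>Updating an absent key amounts to adding a term, so \<open>update_induct\<close>
    becomes induction over the terms of a polynomial.\<close>
  have update: "Poly_Mapping.update a b f = f + Poly_Mapping.single a b"
    if "a \<notin> Poly_Mapping.keys f" for a b and f :: "('v, 'c::field) mpoly"
    using that by (intro poly_mapping_eqI)
      (auto simp: lookup_update lookup_add lookup_single when_def in_keys_iff)
  have single: "rename_poly \<pi> (Poly_Mapping.single a b * q') =
      rename_poly \<pi> (Poly_Mapping.single a b) * rename_poly \<pi> q'" for a b
    by (induction q' rule: update_induct)
      (simp_all add: update rename_poly_0 rename_poly_add rename_poly_single mult_single
        rename_mon_add distrib_left)
  show ?thesis
    by (induction q rule: update_induct)
      (simp_all add: update rename_poly_0 rename_poly_add single distrib_right)
qed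

lemma rename_poly_mmonom: "rename_poly \<pi> (mmonom c) = mmonom (rename_mon \<pi> c)"
  by (simp add: mmonom_def rename_poly_single)

lemma rename_poly_mconst: "rename_poly \<pi> (mconst a) = mconst a"
  by (simp add: mconst_def rename_poly_single rename_mon_0)

lemma rename_poly_var: "rename_poly \<pi> (var v) = var (\<pi> v)"
  by (simp add: var_def rename_poly_mmonom rename_mon_single)

lemma rename_poly_1: "rename_poly \<pi> 1 = 1"
  using rename_poly_mconst[of 1] by (simp add: mconst_def)

lemma rename_poly_prod_var: "rename_poly \<pi> (\<Prod>v\<in>C. var v) = (\<Prod>v\<in>\<pi> ` C. var v)"
proof -
  have "rename_poly \<pi> (\<Prod>v\<in>C. var v) = (\<Prod>v\<in>C. var (\<pi> v))"
    by (induction C rule: infinite_finite_induct)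
      (simp_all add: rename_poly_1 rename_poly_mult rename_poly_var)
  also have "\<dots> = (\<Prod>v\<in>\<pi> ` C. var v)"
    using inj_pi by (subst prod.reindex) (auto intro: inj_on_subset)
  finally show ?thesis .
qed

lemma rename_poly_mem_poly_ring:
  "rename_poly \<pi> q \<in> poly_ring (\<pi> ` V) \<longleftrightarrow> q \<in> poly_ring V"
  using inj_pi by (simp add: poly_ring_def keys_rename_poly keys_rename_mon inj_image_subset_iff)

text \<open>Renaming moves exponents to other variables without changing them, so the total degree
  of each monomial is preserved.\<close>

lemma rename_poly_mem_homogeneous_part:
  "rename_poly \<pi> q \<in> homogeneous_part d \<longleftrightarrow> q \<in> homogeneous_part d"
proof -
  have "(\<Sum>v\<in>\<pi> ` Poly_Mapping.keys c. Poly_Mapping.lookup (rename_mon \<pi> c) v) =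
      (\<Sum>v\<in>Poly_Mapping.keys c. Poly_Mapping.lookup c v)" for c
    using inj_pi by (subst sum.reindex) (auto intro: inj_on_subset simp: lookup_rename_mon)
  then show ?thesis
    by (simp add: homogeneous_part_def keys_rename_poly keys_rename_mon)
qed

text \<open>An injective map that respects sums and products and carries one polynomial ring onto
  the other preserves and reflects every closure condition.\<close>

lemma is_ideal_rename_poly:
  fixes I :: "('v, 'k::field) mpoly set"
  shows "is_ideal (poly_ring (\<pi> ` V)) (rename_poly \<pi> ` I) \<longleftrightarrow> is_ideal (poly_ring V) I"
proof -
  have inj: "inj (rename_poly \<pi> :: ('v, 'k) mpoly \<Rightarrow> _)"
    using bij_rename_poly by (rule bij_is_inj)
  have ring: "poly_ring (\<pi> ` V) = rename_poly \<pi> ` (poly_ring V :: ('v, 'k) mpoly set)"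
  proof
    show "poly_ring (\<pi> ` V) \<subseteq> rename_poly \<pi> ` (poly_ring V :: ('v, 'k) mpoly set)"
      by (metis bij_rename_poly bij_pointE image_eqI rename_poly_mem_poly_ring subsetI)
  qed (auto simp: rename_poly_mem_poly_ring)
  \<comment> \<open>Here 0 has to be recognised as its own image before injectivity can cancel the
    renaming.\<close>
  have zero: "0 \<in> rename_poly \<pi> ` I \<longleftrightarrow> 0 \<in> I"
    using inj_image_mem_iff[OF inj, of 0 I] by (simp add: rename_poly_0)
  show ?thesis
    using inj by (simp add: is_ideal_def ring zero inj_image_subset_iff inj_image_mem_iff
        flip: rename_poly_add rename_poly_mult)
qed

section \<open>Coefficientwise renaming in S[t]\<close>

text \<open>\<open>map_poly\<close> acts on each coefficient because
  \<open>rename_poly \<pi>\<close> fixes 0; the variable t is untouched.\<close>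

lemma coeff_rename_tpoly: "coeff (rename_tpoly \<pi> q) k = rename_poly \<pi> (coeff q k)"
  by (simp add: rename_tpoly_def coeff_map_poly rename_poly_0)

lemma rename_tpoly_monom: "rename_tpoly \<pi> (monom u k) = monom (rename_poly \<pi> u) k"
  by (intro poly_eqI) (simp add: coeff_rename_tpoly coeff_monom rename_poly_0)

lemma rename_tpoly_add: "rename_tpoly \<pi> (q + q') = rename_tpoly \<pi> q + rename_tpoly \<pi> q'"
  by (intro poly_eqI) (simp add: coeff_rename_tpoly rename_poly_add)

lemma rename_tpoly_mult: "rename_tpoly \<pi> (q * q') = rename_tpoly \<pi> q * rename_tpoly \<pi> q'"
proof (rule poly_eqI)
  fix k
  have sum: "rename_poly \<pi> (sum h A) = (\<Sum>i\<in>A. rename_poly \<pi> (h i))"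
    for h :: "nat \<Rightarrow> ('v, 'k::field) mpoly" and A
    by (induction A rule: infinite_finite_induct) (simp_all add: rename_poly_0 rename_poly_add)
  show "coeff (rename_tpoly \<pi> (q * q')) k = coeff (rename_tpoly \<pi> q * rename_tpoly \<pi> q') k"
    by (simp add: coeff_rename_tpoly coeff_mult sum rename_poly_mult)
qed

text \<open>Constants involve no variables, so renaming fixes them and is linear over K.\<close>

lemma rename_tpoly_kscale: "rename_tpoly \<pi> (kscale a q) = kscale a (rename_tpoly \<pi> q)"
  by (intro poly_eqI)
    (simp add: kscale_def coeff_rename_tpoly rename_poly_mult rename_poly_mconst)

lemma rename_tpoly_1: "rename_tpoly \<pi> 1 = 1"
  by (simp add: rename_tpoly_def rename_poly_1)

lemma rename_tpoly_prod_list: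
  "rename_tpoly \<pi> (prod_list fs) = prod_list (map (rename_tpoly \<pi>) fs)"
  by (induction fs) (simp_all add: rename_tpoly_1 rename_tpoly_mult)

lemma bij_rename_tpoly: "bij (rename_tpoly \<pi> :: ('v, 'k::field) mpoly poly \<Rightarrow> _)"
proof (rule bijI)
  let ?Q = "rename_poly \<pi> :: ('v, 'k) mpoly \<Rightarrow> _"
  have Q: "inj ?Q" "surj ?Q"
    using bij_rename_poly by (auto simp: bij_def)
  show "inj (rename_tpoly \<pi> :: ('v, 'k) mpoly poly \<Rightarrow> _)"
    using Q(1) by (intro injI poly_eqI) (metis coeff_rename_tpoly injD)
  \<comment> \<open>\<open>coeff_map_poly\<close> applies only to maps that fix 0, here to the
    inverse used for the preimage of \<open>q\<close>.\<close>
  have 0: "inv ?Q 0 = 0"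
    using Q(1) by (metis inv_f_f rename_poly_0)
  have "q = rename_tpoly \<pi> (map_poly (inv ?Q) q)" for q
    using Q(2) by (intro poly_eqI) (simp add: coeff_rename_tpoly coeff_map_poly 0 surj_f_inv_f)
  then show "surj (rename_tpoly \<pi> :: ('v, 'k) mpoly poly \<Rightarrow> _)"
    by blast
qed

lemma linear_rename_tpoly:
  "Vector_Spaces.linear kscale kscale (rename_tpoly \<pi> :: ('v, 'k::field) mpoly poly \<Rightarrow> _)"
  unfolding Vector_Spaces.linear_def module_hom_def module_hom_axioms_def
  by (simp add: rename_tpoly_add rename_tpoly_kscale module_iff_vector_space vector_space_kscale)

text \<open>The scalars \<open>kscale a 1\<close> are fixed, and injectivity transfers closure under
  sums and products in both directions.\<close>

lemma is_subalgebra_rename_tpoly: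
  fixes A :: "('v, 'k::field) mpoly poly set"
  shows "is_subalgebra (rename_tpoly \<pi> ` A) \<longleftrightarrow> is_subalgebra A"
proof -
  have inj: "inj (rename_tpoly \<pi> :: ('v, 'k) mpoly poly \<Rightarrow> _)"
    using bij_rename_tpoly by (rule bij_is_inj)
  have "kscale a 1 \<in> rename_tpoly \<pi> ` A \<longleftrightarrow> kscale a 1 \<in> A" for a
    using inj_image_mem_iff[OF inj, of "kscale a 1" A]
    by (simp add: rename_tpoly_kscale rename_tpoly_1)
  then show ?thesis
    using inj by (simp add: is_subalgebra_def inj_image_mem_iff
        flip: rename_tpoly_add rename_tpoly_mult)
qed

section \<open>Relabelling the graph\<close>

lemma k_vertex_cover_relabel:
  "k_vertex_cover (relabel_graph \<pi> G) k (rename_mon \<pi> c) \<longleftrightarrow> k_vertex_cover G k c"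
proof -
  have edge: "{\<pi> v, \<pi> w} \<in> (`) \<pi> ` edges G \<longleftrightarrow> {v, w} \<in> edges G" for v w
  proof -
    have "inj ((`) \<pi>)"
      using inj_pi by (simp add: inj_def inj_image_eq_iff)
    then show ?thesis
      using inj_image_mem_iff[of "(`) \<pi>" "{v, w}" "edges G"] by simp
  qed
  \<comment> \<open>Every element of the target type has the form \<open>\<pi> v\<close>, so the
    quantifiers over edge ends can be pulled back.\<close>
  have all: "(\<forall>v w. R v w) \<longleftrightarrow> (\<forall>v w. R (\<pi> v) (\<pi> w))" for R
    using bij by (metis bij_pointE)
  show ?thesis
    unfolding k_vertex_cover_def relabel_graph_def fst_conv snd_conv
    using inj_pi
    by (subst all) (simp add: keys_rename_mon lookup_rename_mon edge
        inj_image_subset_iff)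
qed

text \<open>Since \<open>rename_mon \<pi>\<close> is surjective, every cover of the relabelled graph
  is a renamed cover. The parameter \<open>g\<close> leaves open what is built from a cover.\<close>

lemma k_vertex_covers_relabel:
  "{g c k |c k. k_vertex_cover (relabel_graph \<pi> G) k c} =
    {g (rename_mon \<pi> c) k |c k. k_vertex_cover G k c}"
  using bij_rename_mon k_vertex_cover_relabel by (metis (no_types, opaque_lifting) bij_pointE)

lemma vertex_cover_relabel: "vertex_cover (relabel_graph \<pi> G) (\<pi> ` C) \<longleftrightarrow> vertex_cover G C"
  using inj_pi by (simp add: vertex_cover_def relabel_graph_def inj_image_subset_iff
      flip: image_Int)

lemma ex_image_pi: "\<exists>C. D = \<pi> ` C"
  using bij by (metis bij_is_surj surj_image_vimage_eq)

text \<open>Every set is an image under \<open>\<pi>\<close>, and images preserve and reflect proper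
  inclusion, so the smaller candidates on both sides correspond.\<close>

lemma minimal_vertex_cover_relabel:
  "minimal_vertex_cover (relabel_graph \<pi> G) (\<pi> ` C) \<longleftrightarrow> minimal_vertex_cover G C"
proof -
  have all: "(\<forall>D. R D) \<longleftrightarrow> (\<forall>D. R (\<pi> ` D))" for R
    by (metis ex_image_pi)
  have psub: "\<pi> ` D \<subset> \<pi> ` C \<longleftrightarrow> D \<subset> C" for D
    using inj_pi by (simp add: psubset_eq inj_image_subset_iff inj_image_eq_iff)
  show ?thesis
    unfolding minimal_vertex_cover_def by (subst all) (simp add: vertex_cover_relabel psub)
qed

section \<open>Transport of cover ideals, vertex cover algebras and Hilbert functions\<close>

text \<open>Renaming the monomial of a cover gives the monomial of the renamed cover, and ideals go
  to ideals, so \<open>hull_image_bij\<close> applies.\<close>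

lemma cover_ideal_relabel:
  "cover_ideal (relabel_graph \<pi> G) = rename_poly \<pi> ` (cover_ideal G :: ('v, 'k::field) mpoly set)"
proof -
  have gens: "{mmonom c |c. k_vertex_cover (relabel_graph \<pi> G) 1 c} =
      rename_poly \<pi> ` {mmonom c :: ('v, 'k) mpoly |c. k_vertex_cover G 1 c}"
  proof -
    have "{mmonom c |c. k_vertex_cover (relabel_graph \<pi> G) 1 c} =
        {mmonom (rename_mon \<pi> c) |c. k_vertex_cover G 1 c}"
      using bij_rename_mon k_vertex_cover_relabel by (metis (no_types, opaque_lifting) bij_pointE)
    also have "\<dots> = rename_poly \<pi> ` {mmonom c |c. k_vertex_cover G 1 c}"
      unfolding rename_poly_mmonom[symmetric] by blast
    finally show ?thesis .
  qed
  have verts: "vertices (relabel_graph \<pi> G) = \<pi> ` vertices G"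
    by (simp add: relabel_graph_def)
  show ?thesis
    unfolding cover_ideal_def gens verts
    by (rule hull_image_bij[symmetric]) (rule bij_rename_poly is_ideal_rename_poly)+
qed

lemma vertex_cover_algebra_relabel:
  "vertex_cover_algebra (relabel_graph \<pi> G) = rename_tpoly \<pi> ` vertex_cover_algebra G"
proof -
  have "{monom (mmonom c) k |c k. k_vertex_cover (relabel_graph \<pi> G) k c} =
      {rename_tpoly \<pi> (monom (mmonom c) k) |c k. k_vertex_cover G k c}"
    unfolding k_vertex_covers_relabel by (simp add: rename_tpoly_monom rename_poly_mmonom)
  also have "\<dots> = rename_tpoly \<pi> ` {monom (mmonom c) k |c k. k_vertex_cover G k c}"
    by auto
  finally have gens: "{monom (mmonom c) k |c k. k_vertex_cover (relabel_graph \<pi> G) k c} = \<dots>" .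
  show ?thesis
    unfolding vertex_cover_algebra_def gens
    by (rule hull_image_bij[symmetric]) (rule bij_rename_tpoly is_subalgebra_rename_tpoly)+
qed

text \<open>The grading is defined through these generators, so they must be matched as well:
  variables go to variables and minimal covers to minimal covers.\<close>

lemma degree_one_generators_relabel:
  "degree_one_generators (relabel_graph \<pi> G) =
    rename_tpoly \<pi> ` (degree_one_generators G :: ('v, 'k::field) mpoly poly set)"
proof -
  have "{monom (var v) 0 |v. v \<in> vertices (relabel_graph \<pi> G)} =
      rename_tpoly \<pi> ` {monom (var v :: ('v, 'k) mpoly) 0 |v. v \<in> vertices G}"
    by (simp add: relabel_graph_def setcompr_eq_image image_image rename_tpoly_monom
        rename_poly_var)
  moreover have "{monom (\<Prod>v\<in>C. var v) 1 |C. minimal_vertex_cover (relabel_graph \<pi> G) C} =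
      {monom (\<Prod>v\<in>\<pi> ` C. var v) 1 |C. minimal_vertex_cover G C}"
    using minimal_vertex_cover_relabel ex_image_pi by metis
  then have "{monom (\<Prod>v\<in>C. var v) 1 |C. minimal_vertex_cover (relabel_graph \<pi> G) C} =
      rename_tpoly \<pi> ` {monom (\<Prod>v\<in>C. var v :: ('v, 'k) mpoly) 1 |C. minimal_vertex_cover G C}"
    by (simp add: setcompr_eq_image image_image rename_tpoly_monom rename_poly_prod_var)
  ultimately show ?thesis
    unfolding degree_one_generators_def image_Un by simp
qed

lemma graded_vs_isomorphic_relabel:
  "graded_vs_isomorphic (cover_ideal G) (cover_ideal (relabel_graph \<pi> G))"
  unfolding graded_vs_isomorphic_def cover_ideal_relabel
proof (intro exI[of _ "rename_poly \<pi>"] conjI ballI allI)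
  show "bij_betw (rename_poly \<pi>) (cover_ideal G) (rename_poly \<pi> ` cover_ideal G)"
    using bij_rename_poly by (meson bij_betw_subset subset_UNIV)
  show "rename_poly \<pi> ` (cover_ideal G \<inter> homogeneous_part d) =
      rename_poly \<pi> ` cover_ideal G \<inter> homogeneous_part d" for d
    by (auto simp: rename_poly_mem_homogeneous_part)
qed (simp_all add: rename_poly_add rename_poly_mult rename_poly_mconst)

text \<open>The renaming respects products, commutes with spans by linearity, and commutes with
  intersections by injectivity.\<close>

lemma standard_component_rename_tpoly:
  "standard_component (rename_tpoly \<pi> ` A) (rename_tpoly \<pi> ` D) d =
    rename_tpoly \<pi> ` standard_component A D d"
proof -
  let ?T = "rename_tpoly \<pi>"
  interpret T: Vector_Spaces.linear kscale kscale ?T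
    by (rule linear_rename_tpoly)
  \<comment> \<open>Words over the image of \<open>D\<close> are letterwise images of words over
    \<open>D\<close>; \<open>lists_image\<close> supplies the preimages of all letters at
    once.\<close>
  have "{fs. set fs \<subseteq> ?T ` D \<and> length fs = d} = map ?T ` {fs. set fs \<subseteq> D \<and> length fs = d}"
  proof -
    have "fs \<in> map ?T ` {fs. set fs \<subseteq> D \<and> length fs = d}"
      if "set fs \<subseteq> ?T ` D" "length fs = d" for fs
    proof -
      have "fs \<in> map ?T ` lists D"
        using that(1) unfolding lists_image[symmetric] by (simp add: lists_eq_set)
      then show ?thesis
        using that(2) by (auto simp: lists_eq_set)
    qed
    then show ?thesis
      by (auto intro!: imageI)
  qed
  then have "{prod_list fs |fs. set fs \<subseteq> ?T ` D \<and> length fs = d} =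
      ?T ` {prod_list fs |fs. set fs \<subseteq> D \<and> length fs = d}"
    by (simp add: setcompr_eq_image image_image rename_tpoly_prod_list)
  then show ?thesis
    unfolding standard_component_def
    by (simp add: T.span_image image_Int[OF bij_is_inj[OF bij_rename_tpoly]])
qed

text \<open>An injective linear map carries each component onto the corresponding one. The
  comparison rests on the isomorphism of algebras, not on that of the cover ideals.\<close>

lemma hilbert_function_relabel:
  "hilbert_function (vertex_cover_algebra (relabel_graph \<pi> G) :: ('w, 'k::field) mpoly poly set)
      (degree_one_generators (relabel_graph \<pi> G)) =
    hilbert_function (vertex_cover_algebra G :: ('v, 'k) mpoly poly set) (degree_one_generators G)"
  by (simp add: fun_eq_iff dim_image_inj[OF linear_rename_tpoly bij_is_inj[OF bij_rename_tpoly]]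
      hilbert_function_def vertex_cover_algebra_relabel degree_one_generators_relabel
      standard_component_rename_tpoly)

end

section \<open>From poset isomorphisms to permutations of the vertices\<close>

lemma poset_iso_imp_relabel:
  assumes p: "bij_betw p {1..n} P" and p': "bij_betw p' {1..n} P'"
    and iso: "poset_iso P r P' r' f"
  obtains \<pi> where "bij \<pi>" "poset_graph n p' r' = relabel_graph \<pi> (poset_graph n p r)"
proof -
  \<comment> \<open>\<open>g i\<close> is the index, in the second enumeration, of the image under
    \<open>f\<close> of the element with index \<open>i\<close>.\<close>
  define g where "g = inv_into {1..n} p' \<circ> (f \<circ> p)"
  \<comment> \<open>The type \<open>vertex\<close> also has indices outside \<open>{1..n}\<close>;
    the identity there yields a bijection of the whole type, as relabelling requires.\<close>
  define \<tau> where "\<tau> i = (if i \<in> {1..n} then g i else i)" for i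
  \<comment> \<open>One permutation of the indices acts on both sides of the bipartition.\<close>
  define \<pi> where "\<pi> v = (case v of X i \<Rightarrow> X (\<tau> i) | Y i \<Rightarrow> Y (\<tau> i))" for v
  have f: "bij_betw f P P'" "\<And>a b. a \<in> P \<Longrightarrow> b \<in> P \<Longrightarrow> (a, b) \<in> r \<longleftrightarrow> (f a, f b) \<in> r'"
    using iso by (auto simp: poset_iso_def)
  have "bij_betw g {1..n} {1..n}"
    unfolding g_def using p f(1) p' by (meson bij_betw_inv_into bij_betw_trans)
  then have \<tau>n: "bij_betw \<tau> {1..n} {1..n}"
    by (rule bij_betw_cong[THEN iffD1, rotated]) (simp add: \<tau>_def)
  have "bij_betw \<tau> (- {1..n}) (- {1..n})"
    by (auto simp: \<tau>_def bij_betw_def inj_on_def)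
  then have \<tau>: "bij \<tau>"
    using bij_betw_combine[OF \<tau>n, of "- {1..n}" "- {1..n}"]
    by (simp only: Compl_partition Compl_disjoint)
  \<comment> \<open>On \<open>{1..n}\<close>, \<open>p' (\<tau> i)\<close> is \<open>f (p i)\<close>
    by the choice of \<open>g\<close>, so this is the order equivalence for
    \<open>f\<close>.\<close>
  have edge: "(p' (\<tau> i), p' (\<tau> j)) \<in> r' \<longleftrightarrow> (p i, p j) \<in> r"
    if "i \<in> {1..n}" "j \<in> {1..n}" for i j
  proof -
    have "p' (\<tau> i) = f (p i)" if "i \<in> {1..n}" for i
      using that p f(1) p' bij_betw_inv_into_right[of p' "{1..n}" P' "f (p i)"]
      by (simp add: \<tau>_def g_def bij_betwE)
    then show ?thesis
      using that f(2) p by (simp add: bij_betwE)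
  qed
  have "bij \<pi>"
  proof (rule bijI)
    show "inj \<pi>"
      using \<tau> by (intro injI) (auto simp: \<pi>_def split: vertex.splits dest: bij_is_inj injD)
    have "\<exists>u. v = \<pi> u" for v
    proof (cases v)
      case (X i)
      then have "v = \<pi> (X (inv \<tau> i))"
        using \<tau> by (simp add: \<pi>_def bij_is_surj surj_f_inv_f)
      then show ?thesis ..
    next
      case (Y i)
      then have "v = \<pi> (Y (inv \<tau> i))"
        using \<tau> by (simp add: \<pi>_def bij_is_surj surj_f_inv_f)
      then show ?thesis ..
    qed
    then show "surj \<pi>"
      by blast
  qed
  moreover have "poset_graph n p' r' = relabel_graph \<pi> (poset_graph n p r)"
  proof -
    \<comment> \<open>Since \<open>\<tau>\<close> permutes \<open>{1..n}\<close>, indices on the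
      primed side may be written as values of \<open>\<tau>\<close>; both the vertex sets and the
      edge sets are compared this way.\<close>
    have img: "\<tau> ` {1..n} = {1..n}"
      using \<tau>n by (rule bij_betw_imp_surj_on)
    have "X ` {1..n} \<union> Y ` {1..n} = \<pi> ` (X ` {1..n} \<union> Y ` {1..n})"
      by (subst (1 2) img[symmetric]) (auto simp: \<pi>_def image_Un image_image
          simp del: atLeastAtMost_iff)
    moreover have "{{X i, Y j} |i j. i \<in> {1..n} \<and> j \<in> {1..n} \<and> (p' i, p' j) \<in> r'} =
        (`) \<pi> ` {{X i, Y j} |i j. i \<in> {1..n} \<and> j \<in> {1..n} \<and> (p i, p j) \<in> r}" (is "?L = ?R")
    proof -
      have "?L = {{X i, Y j} |i j. i \<in> \<tau> ` {1..n} \<and> j \<in> \<tau> ` {1..n} \<and> (p' i, p' j) \<in> r'}"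
        unfolding img ..
      also have "\<dots> = {{X (\<tau> i), Y (\<tau> j)} |i j. i \<in> {1..n} \<and> j \<in> {1..n} \<and> (p i, p j) \<in> r}"
        using edge by blast
      also have "\<dots> = {\<pi> ` {X i, Y j} |i j. i \<in> {1..n} \<and> j \<in> {1..n} \<and> (p i, p j) \<in> r}"
        by (simp add: \<pi>_def)
      also have "\<dots> = ?R"
        by blast
      finally show ?thesis .
    qed
    ultimately show ?thesis
      by (simp add: poset_graph_def relabel_graph_def)
  qed
  ultimately show ?thesis
    by (rule that)
qed

theorem mainTheorem8:
  fixes n :: nat
    and P :: "'a set" and r :: "'a rel" and p :: "nat \<Rightarrow> 'a"
    and P' :: "'b set" and r' :: "'b rel" and p' :: "nat \<Rightarrow> 'b"
    and G G' :: "vertex graph"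
  assumes "partial_order_on P r" and "bij_betw p {1..n} P"
    and "partial_order_on P' r'" and "bij_betw p' {1..n} P'"
    and "\<exists>f. poset_iso P r P' r' f"
    and "G = poset_graph n p r" and "G' = poset_graph n p' r'"
  shows "graded_vs_isomorphic (cover_ideal G :: (vertex, 'k::field) mpoly set) (cover_ideal G') \<and>
         hilbert_function
           (vertex_cover_algebra G :: (vertex, 'k) mpoly poly set) (degree_one_generators G) =
         hilbert_function
           (vertex_cover_algebra G' :: (vertex, 'k) mpoly poly set) (degree_one_generators G') \<and>
         hilbert_series
           (vertex_cover_algebra G :: (vertex, 'k) mpoly poly set) (degree_one_generators G) =
         hilbert_series
           (vertex_cover_algebra G' :: (vertex, 'k) mpoly poly set) (degree_one_generators G')"
proof -
  obtain f where "poset_iso P r P' r' f"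
    using assms(5) ..
  then obtain \<pi> where \<pi>: "bij \<pi>" "G' = relabel_graph \<pi> G"
    unfolding assms(6,7) by (rule poset_iso_imp_relabel[OF assms(2,4)])
  show ?thesis
    \<comment> \<open>The series has the values of the Hilbert function as coefficients, so its
      equality follows from that of the functions.\<close>
    unfolding \<pi>(2) hilbert_series_def
    by (simp add: graded_vs_isomorphic_relabel[OF \<pi>(1)] hilbert_function_relabel[OF \<pi>(1)])
qed

end
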